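(* Let $(\mathcal D_n)_{n\in\mathbb N}$ be a sequence of samples with observational errors bounded by $\bar{\mathfrak e}\in\mathbb R_{\ge0}$. Set the parameters of the LACKI rule to $\underline B=-\infty$, $\bar B=\infty$, $\underline L=0$ and $\lambda:=2\bar{\mathfrak e}+q$ for some $q>0$. Assume that the set of interest $I\subseteq\mathcal X$ is compact. Then the LACKI rule is a universal approximator in the following sense: if the sequence of input grids $(G_n)_{n\in\mathbb N}$ becomes dense relative to $I$ (uniformly), then the sequence of LACKI predictors $(\hat f_n)_{n\in\mathbb N}$ converges (uniformly) to any continuous target $f:\mathcal X\to\mathbb R$ up to error $2\bar{\mathfrak e}+\frac{3q}2$. That is: (I) Let $x\in I$. If there is a rate $r_x\in o(1)$ such that $(G_n)$ becomes dense relative to $x$ with rate $r_x$, then there is $C\in\mathbb R$ such that $\big(|\hat f_n(x)-f(x)|\big)_{n\in\mathbb N}$ converges to $[0,2\bar{\mathfrak e}+\frac{3q}2]$ with rate $C\,r_x^\alpha$. (II) If there is a rate $r\in o(1)$ such that $(G_n)$ becomes dense relative to $I$ uniformly with rate $r$, then there is $C\in\mathbb R$ such that the sequence of worst-case errors $\mathcal E^\infty_n=\sup_{x\in I}|\hat f_n(x)-f(x)|$ converges to $[0,2\bar{\mathfrak e}+\frac{3q}2]$ with rate $C\,r^\alpha$.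
   Context: Setting. $\mathcal X$ is an additive abelian group with a translation-invariant pseudo-metric $\mathfrak d$. $f:\mathcal X\to\mathbb R$ is the target and $\tilde f:\mathcal X\to\mathbb R$ the noise-corrupted observable; errors bounded by $\bar{\mathfrak e}$ means $|\tilde f(x)-f(x)|\le\bar{\mathfrak e}$ for all $x\in\mathcal X$. For each $n\in\mathbb N$ there is a finite data set $\mathcal D_n=\{(s_i,\tilde f_i):i=1,\dots,N_n\}$ with $s_i\in\mathcal X$, $\tilde f_i=\tilde f(s_i)$; $G_n=\{s_1,\dots,s_{N_n}\}$. LACKI predictor. Let $\alpha\in(0,1]$, and let $e:\mathcal X\to\mathbb R_{\ge0}$ be a parameter function. In general the rule also has a priori lower and upper bound functions $\underline B,\bar B$; with $\underline B=-\infty$, $\bar B=\infty$ the rule reads $$\hat f_n(x)=\tfrac12\min_i\big(\tilde f_i+L(n)\mathfrak d(x,s_i)^\alpha+e(x)\big)+\tfrac12\max_i\big(\tilde f_i-L(n)\mathfrak d(x,s_i)^\alpha-e(x)\big),$$ where, with $U_n=\{(s,s')\in G_n\times G_n:\mathfrak d(s,s')>0\}$, $$L(n):=\max\Big\{\underline L,\ \max_{(s,s')\in U_n}\frac{|\tilde f(s)-\tilde f(s')|-\lambda}{\mathfrak d(s,s')^\alpha}\Big\}.$$ Rates. $r\in o(1)$ means $r:\mathbb N\to\mathbb R$ with $r(n)\to0$. A real sequence $(a_n)$ converges to a set $S$ with rate $\varrho$ if $\inf_{y\in S}|y-a_n|\le\varrho(n)$ for all $n$ and $\varrho(n)\to0$.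 $(G_n)$ becomes dense relative to a point $x$ with rate $r$ if there are $g_n\in G_n$ with $\mathfrak d(x,g_n)\le r(n)$ for all $n$, where $r(n)\to0$. $(G_n)$ becomes dense relative to $I$ uniformly with rate $r$ if $\sup_{x\in I}\inf_{g\in G_n}\mathfrak d(x,g)\le r(n)$ for all $n$, where $r(n)\to0$.
   Formalization: The formal theorem additionally assumes that all input grids G_n lie in one common compact subset of X (not necessarily I), since otherwise far-away samples can make L(n) blow up and the claim fails; I is also taken to be nonempty. *)

theory Defs
  imports "HOL-Analysis.Analysis"
begin

definition invariant_pseudometric :: "('a::ab_group_add \<Rightarrow> 'a \<Rightarrow> real) \<Rightarrow> bool" where
  "invariant_pseudometric d \<longleftrightarrow>
     (\<forall>x y. 0 \<le> d x y) \<and> (\<forall>x. d x x = 0) \<and> (\<forall>x y. d x y = d y x) \<and>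
     (\<forall>x y z. d x z \<le> d x y + d y z) \<and> (\<forall>x y z. d (x + z) (y + z) = d x y)"

(* Metric_space.mtopology needs d x y = 0 to imply x = y, so the (in general non-Hausdorff)
   topology of a pseudo-metric is introduced here; compactness and continuity with respect to
   it are the library's compactin and continuous_map. *)
definition pm_topology :: "('a \<Rightarrow> 'a \<Rightarrow> real) \<Rightarrow> 'a topology" where
  "pm_topology d = topology (\<lambda>U. \<forall>x\<in>U. \<exists>\<epsilon>>0. {y. d x y < \<epsilon>} \<subseteq> U)"

lemma openin_pm_topology:
  "openin (pm_topology d) U \<longleftrightarrow> (\<forall>x\<in>U. \<exists>\<epsilon>>0. {y. d x y < \<epsilon>} \<subseteq> U)"
proof -
  have "istopology (\<lambda>U. \<forall>x\<in>U. \<exists>\<epsilon>>0. {y. d x y < \<epsilon>} \<subseteq> U)"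
    unfolding istopology_def
  proof (intro conjI allI impI ballI)
    fix S T x
    assume S: "\<forall>x\<in>S. \<exists>\<epsilon>>0. {y. d x y < \<epsilon>} \<subseteq> S"
      and T: "\<forall>x\<in>T. \<exists>\<epsilon>>0. {y. d x y < \<epsilon>} \<subseteq> T" and x: "x \<in> S \<inter> T"
    obtain a b where "a > 0" "{y. d x y < a} \<subseteq> S" "b > 0" "{y. d x y < b} \<subseteq> T"
      using S T x by blast
    then show "\<exists>\<epsilon>>0. {y. d x y < \<epsilon>} \<subseteq> S \<inter> T"
      by (intro exI[of _ "min a b"]) auto
  next
    fix \<K> x
    assume "\<forall>K\<in>\<K>. \<forall>x\<in>K. \<exists>\<epsilon>>0. {y. d x y < \<epsilon>} \<subseteq> K" "x \<in> \<Union>\<K>"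
    then show "\<exists>\<epsilon>>0. {y. d x y < \<epsilon>} \<subseteq> \<Union>\<K>" by (meson Union_iff Sup_upper subset_trans)
  qed
  then show ?thesis unfolding pm_topology_def by (simp add: topology_inverse')
qed

lemma topspace_pm_topology [simp]: "topspace (pm_topology d) = UNIV"
proof -
  have "openin (pm_topology d) UNIV"
    by (auto simp: openin_pm_topology intro: exI[of _ 1])
  then show ?thesis by (simp add: openin_subset top.extremum_uniqueI)
qed

definition data_set :: "('a \<Rightarrow> real) \<Rightarrow> ('a \<times> real) set \<Rightarrow> bool" where
  "data_set ftilde D \<longleftrightarrow> finite D \<and> D \<noteq> {} \<and> (\<forall>(s, y)\<in>D. y = ftilde s)"

abbreviation grid :: "('a \<times> real) set \<Rightarrow> 'a set" where
  "grid D \<equiv> fst ` D"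

(* If no two grid points have positive distance, this is the lower bound Llow. *)
definition lacki_const ::
  "('a \<Rightarrow> 'a \<Rightarrow> real) \<Rightarrow> real \<Rightarrow> real \<Rightarrow> real \<Rightarrow> ('a \<times> real) set \<Rightarrow> real" where
  "lacki_const d \<alpha> Llow lam D =
     Max (insert Llow
       {(\<bar>y - y'\<bar> - lam) / d s s' powr \<alpha> | s y s' y'. (s, y) \<in> D \<and> (s', y') \<in> D \<and> 0 < d s s'})"

(* The rule for the a priori bounds -\<infinity> and \<infinity>, which therefore do not occur. *)
definition lacki ::
  "('a \<Rightarrow> 'a \<Rightarrow> real) \<Rightarrow> real \<Rightarrow> real \<Rightarrow> real \<Rightarrow> ('a \<Rightarrow> real) \<Rightarrow> ('a \<times> real) set \<Rightarrow> 'a \<Rightarrow> real" where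
  "lacki d \<alpha> Llow lam e D x =
     1/2 * Min ((\<lambda>(s, y). y + lacki_const d \<alpha> Llow lam D * d x s powr \<alpha> + e x) ` D) +
     1/2 * Max ((\<lambda>(s, y). y - lacki_const d \<alpha> Llow lam D * d x s powr \<alpha> - e x) ` D)"

definition converges_to_set_with_rate ::
  "(nat \<Rightarrow> real) \<Rightarrow> real set \<Rightarrow> (nat \<Rightarrow> real) \<Rightarrow> bool" where
  "converges_to_set_with_rate a S \<rho> \<longleftrightarrow>
     (\<forall>n. (INF y\<in>S. \<bar>y - a n\<bar>) \<le> \<rho> n) \<and> \<rho> \<longlonglongrightarrow> 0"

definition dense_at_with_rate ::
  "('a \<Rightarrow> 'a \<Rightarrow> real) \<Rightarrow> (nat \<Rightarrow> 'a set) \<Rightarrow> 'a \<Rightarrow> (nat \<Rightarrow> real) \<Rightarrow> bool" where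
  "dense_at_with_rate d G x r \<longleftrightarrow> (\<forall>n. \<exists>g\<in>G n. d x g \<le> r n) \<and> r \<longlonglongrightarrow> 0"

definition uniformly_dense_with_rate ::
  "('a \<Rightarrow> 'a \<Rightarrow> real) \<Rightarrow> (nat \<Rightarrow> 'a set) \<Rightarrow> 'a set \<Rightarrow> (nat \<Rightarrow> real) \<Rightarrow> bool" where
  "uniformly_dense_with_rate d G I r \<longleftrightarrow>
     (\<forall>n. (SUP x\<in>I. INF g\<in>G n. d x g) \<le> r n) \<and> r \<longlonglongrightarrow> 0"

end

theory Submission
  imports Defs
begin

text \<open>Uniform continuity absorbs small distances and boundedness absorbs large ones, so on a
  compact set a continuous target satisfies \<open>\<bar>f x - f y\<bar> \<le> q + C d(x,y)\<^sup>\<alpha>\<close> for some \<open>C\<close>.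
  Because the tolerance \<open>\<lambda> = 2 ebar + q\<close> swallows both the noise and this \<open>q\<close>, the estimated
  constants \<open>L(n)\<close> all stay below \<open>C\<close>, and any two samples \<open>s, s'\<close> satisfy
  \<open>\<bar>ftilde s - ftilde s'\<bar> \<le> \<lambda> + L(n) d(s,s')\<^sup>\<alpha>\<close>. For a grid point \<open>g\<close> close to \<open>x\<close> this places
  the prediction within \<open>\<lambda>/2 + L(n) d(x,g)\<^sup>\<alpha>\<close> of \<open>ftilde g\<close>, which in turn is within
  \<open>ebar + q + C d(x,g)\<^sup>\<alpha>\<close> of \<open>f x\<close>.\<close>

text \<open>After division by \<open>a + b\<close> the two fractions lie in the unit interval, where
  \<open>t \<le> t powr \<alpha>\<close>, and they sum to 1. This makes
  \<open>d x y powr \<alpha>\<close> obey the triangle inequality.\<close>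

lemma powr_add_le_add_powr:
  fixes a b \<alpha> :: real
  assumes "0 \<le> a" "0 \<le> b" "0 < \<alpha>" "\<alpha> \<le> 1"
  shows "(a + b) powr \<alpha> \<le> a powr \<alpha> + b powr \<alpha>"
proof (cases "a + b = 0")
  case True
  then show ?thesis by simp
next
  case False
  then have pos: "0 < a + b" using assms by linarith
  have *: "t / (a + b) \<le> (t / (a + b)) powr \<alpha>" if "0 \<le> t" "t \<le> a + b" for t
    using powr_mono'[of \<alpha> 1 "t / (a + b)"] that pos assms by simp
  have "1 = a / (a + b) + b / (a + b)"
    using pos by (simp add: add_divide_distrib[symmetric])
  also have "\<dots> \<le> (a / (a + b)) powr \<alpha> + (b / (a + b)) powr \<alpha>"
    using *[of a] *[of b] assms by simp
  also have "\<dots> = (a powr \<alpha> + b powr \<alpha>) / (a + b) powr \<alpha>"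
    using assms pos by (simp add: powr_divide add_divide_distrib)
  finally show ?thesis using pos by (simp add: le_divide_eq)
qed

section \<open>Continuity and compactness in the topology of a pseudo-metric\<close>

lemma openin_pm_ball:
  assumes "invariant_pseudometric d"
  shows "openin (pm_topology d) {y. d x y < \<epsilon>}"
  unfolding openin_pm_topology
proof
  fix z assume z: "z \<in> {y. d x y < \<epsilon>}"
  have "{y. d z y < \<epsilon> - d x z} \<subseteq> {y. d x y < \<epsilon>}"
  proof safe
    fix y assume "d z y < \<epsilon> - d x z"
    moreover have "d x y \<le> d x z + d z y"
      using assms unfolding invariant_pseudometric_def by blast
    ultimately show "d x y < \<epsilon>" by linarith
  qed
  then show "\<exists>\<eta>>0. {y. d z y < \<eta>} \<subseteq> {y. d x y < \<epsilon>}"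
    using z by (intro exI[of _ "\<epsilon> - d x z"]) simp
qed

lemma continuous_map_pm_real:
  assumes "invariant_pseudometric d"
  shows "continuous_map (pm_topology d) euclideanreal f \<longleftrightarrow>
    (\<forall>x. \<forall>\<epsilon>>0. \<exists>\<delta>>0. \<forall>y. d x y < \<delta> \<longrightarrow> \<bar>f x - f y\<bar> < \<epsilon>)" (is "_ \<longleftrightarrow> ?R")
proof
  assume c: "continuous_map (pm_topology d) euclideanreal f"
  show ?R
  proof (intro allI impI)
    fix x and \<epsilon> :: real assume "0 < \<epsilon>"
    have "openin (pm_topology d) {y. f y \<in> ball (f x) \<epsilon>}"
      using openin_continuous_map_preimage[OF c, of "ball (f x) \<epsilon>"] by simp
    then show "\<exists>\<delta>>0. \<forall>y. d x y < \<delta> \<longrightarrow> \<bar>f x - f y\<bar> < \<epsilon>"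
      using \<open>0 < \<epsilon>\<close> unfolding openin_pm_topology
      by (auto simp: dist_real_def subset_iff)
  qed
next
  assume R: ?R
  have "\<exists>\<delta>>0. {y. d x y < \<delta>} \<subseteq> {x. f x \<in> U}" if U: "open U" "f x \<in> U" for U x
  proof -
    obtain \<epsilon> where "\<epsilon> > 0" "ball (f x) \<epsilon> \<subseteq> U"
      using U openE by blast
    moreover from R \<open>\<epsilon> > 0\<close> obtain \<delta> where "\<delta> > 0" "\<forall>y. d x y < \<delta> \<longrightarrow> \<bar>f x - f y\<bar> < \<epsilon>"
      by blast
    ultimately show ?thesis
      by (intro exI[of _ \<delta>]) (auto simp: dist_real_def subset_iff)
  qed
  then show "continuous_map (pm_topology d) euclideanreal f"
    unfolding continuous_map_def openin_pm_topology by simp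
qed

lemma continuous_map_pm_bounded:
  fixes f :: "'a::ab_group_add \<Rightarrow> real"
  assumes "continuous_map (pm_topology d) euclideanreal f" "compactin (pm_topology d) K"
  obtains M where "\<And>x. x \<in> K \<Longrightarrow> \<bar>f x\<bar> \<le> M"
proof -
  have "bounded (f ` K)"
    using image_compactin[OF assms(2,1)] compact_imp_bounded by simp
  then show ?thesis using that by (auto simp: bounded_iff)
qed

text \<open>Heine-Cantor: finitely many balls of half the local radius cover \<open>K\<close>. If
  \<open>x\<close> lies in a half ball and \<open>y\<close> is closer to \<open>x\<close> than
  \<open>\<delta>\<close>, both lie in the full ball with the same centre. Hence only
  \<open>x\<close> has to belong to \<open>K\<close>.\<close>

lemma compactin_pm_uniformly_continuous:
  fixes f :: "'a::ab_group_add \<Rightarrow> real"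
  assumes d: "invariant_pseudometric d"
    and f: "continuous_map (pm_topology d) euclideanreal f"
    and K: "compactin (pm_topology d) K" and "0 < \<epsilon>"
  obtains \<delta> where "0 < \<delta>" "\<And>x y. x \<in> K \<Longrightarrow> d x y < \<delta> \<Longrightarrow> \<bar>f x - f y\<bar> < \<epsilon>"
proof -
  have "\<forall>x. \<exists>\<delta>>0. \<forall>y. d x y < \<delta> \<longrightarrow> \<bar>f x - f y\<bar> < \<epsilon> / 2"
    using f half_gt_zero[OF \<open>0 < \<epsilon>\<close>] unfolding continuous_map_pm_real[OF d] by blast
  then obtain \<eta> where \<eta>: "\<And>x. 0 < \<eta> x" "\<And>x y. d x y < \<eta> x \<Longrightarrow> \<bar>f x - f y\<bar> < \<epsilon> / 2"
    by metis
  define B where "B x = {y. d x y < \<eta> x / 2}" for x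
  have dd: "d x x = 0" "d x z \<le> d x y + d y z" for x y z
    using d unfolding invariant_pseudometric_def by blast+
  have "K \<subseteq> \<Union> (B ` K)"
    using \<eta>(1) dd(1) by (auto simp: B_def)
  moreover have "\<forall>U\<in>B ` K. openin (pm_topology d) U"
    using openin_pm_ball[OF d] unfolding B_def by blast
  ultimately obtain \<F> where "finite \<F>" "\<F> \<subseteq> B ` K" "K \<subseteq> \<Union>\<F>"
    using K unfolding compactin_def by meson
  then obtain X where X: "finite X" "K \<subseteq> \<Union> (B ` X)"
    by (metis finite_subset_image)
  \<comment> \<open>The inserted 1 keeps the minimum meaningful when \<open>X\<close> is
    empty.\<close>
  define \<delta> where "\<delta> = Min (insert 1 ((\<lambda>x. \<eta> x / 2) ` X))"
  have "0 < \<delta>" using X(1) \<eta>(1) by (auto simp: \<delta>_def)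
  moreover have "\<bar>f x - f y\<bar> < \<epsilon>" if "x \<in> K" "d x y < \<delta>" for x y
  proof -
    obtain z where z: "z \<in> X" "d z x < \<eta> z / 2"
      using X(2) \<open>x \<in> K\<close> by (auto simp: B_def)
    have "\<delta> \<le> \<eta> z / 2" using X(1) z(1) unfolding \<delta>_def by (intro Min_le) auto
    then have "d z y < \<eta> z" using dd(2)[of z y x] z(2) that(2) by linarith
    moreover have "d z x < \<eta> z" using z(2) \<eta>(1)[of z] by linarith
    ultimately show ?thesis using \<eta>(2)[of z x] \<eta>(2)[of z y] by linarith
  qed
  ultimately show ?thesis using that by blast
qed

text \<open>The distance to a fixed point is 1-Lipschitz, hence continuous, hence bounded on a
  compact set. This later ensures that the supremum in the definition of uniform density is taken
  over a family bounded above.\<close>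

lemma compactin_pm_dist_bounded:
  assumes d: "invariant_pseudometric d" and K: "compactin (pm_topology d) K"
  obtains M where "\<And>x. x \<in> K \<Longrightarrow> d x a \<le> M"
proof -
  have dd: "d y z = d z y" "d x z \<le> d x y + d y z" for x y z
    using d unfolding invariant_pseudometric_def by blast+
  have "\<bar>d x a - d y a\<bar> \<le> d x y" for x y
    using dd(2)[of x a y] dd(2)[of y a x] dd(1)[of x y] by linarith
  then have "continuous_map (pm_topology d) euclideanreal (\<lambda>x. d x a)"
    unfolding continuous_map_pm_real[OF d] by (meson le_less_trans)
  then show ?thesis
    using that continuous_map_pm_bounded[OF _ K] by (metis abs_le_D1)
qed

lemma compactin_pm_hoelder_up_to:
  fixes f :: "'a::ab_group_add \<Rightarrow> real"
  assumes d: "invariant_pseudometric d"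
    and f: "continuous_map (pm_topology d) euclideanreal f"
    and K: "compactin (pm_topology d) K" and "0 < q" "0 < \<alpha>"
  obtains C where "0 \<le> C" "\<And>x y. x \<in> K \<Longrightarrow> y \<in> K \<Longrightarrow> \<bar>f x - f y\<bar> \<le> q + C * d x y powr \<alpha>"
proof -
  obtain \<delta> where \<delta>: "0 < \<delta>" "\<And>x y. x \<in> K \<Longrightarrow> d x y < \<delta> \<Longrightarrow> \<bar>f x - f y\<bar> < q"
    using compactin_pm_uniformly_continuous[OF d f K \<open>0 < q\<close>] by blast
  obtain M where M: "\<And>x. x \<in> K \<Longrightarrow> \<bar>f x\<bar> \<le> M"
    using continuous_map_pm_bounded[OF f K] by blast
  \<comment> \<open>Chosen so that at distance \<open>\<delta>\<close> the power term already equals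
    \<open>2 * \<bar>M\<bar>\<close>, a bound for the oscillation of \<open>f\<close> on
    \<open>K\<close>. The absolute value gives \<open>0 \<le> C\<close> even when \<open>K\<close>
    is empty and \<open>M\<close> is negative.\<close>
  define C where "C = 2 * \<bar>M\<bar> / \<delta> powr \<alpha>"
  have C: "0 \<le> C" by (simp add: C_def)
  have "\<bar>f x - f y\<bar> \<le> q + C * d x y powr \<alpha>" if xy: "x \<in> K" "y \<in> K" for x y
  proof (cases "d x y < \<delta>")
    case True
    moreover have "0 \<le> C * d x y powr \<alpha>" using C by simp
    ultimately show ?thesis using \<delta>(2)[OF xy(1), of y] by linarith
  next
    case False
    have "C * \<delta> powr \<alpha> = 2 * \<bar>M\<bar>" using \<delta>(1) by (simp add: C_def)
    moreover have "C * \<delta> powr \<alpha> \<le> C * d x y powr \<alpha>"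
      using False C \<delta>(1) \<open>0 < \<alpha>\<close> by (intro mult_left_mono powr_mono2) auto
    ultimately show ?thesis
      using M[OF xy(1)] M[OF xy(2)] \<open>0 < q\<close> by linarith
  qed
  then show ?thesis using C that by blast
qed

section \<open>The estimated constant and the error of a single prediction\<close>

lemma finite_lacki_quotients:
  assumes "finite D"
  shows "finite {(\<bar>y - y'\<bar> - lam) / d s s' powr \<alpha> | s y s' y'.
    (s, y) \<in> D \<and> (s', y') \<in> D \<and> 0 < d s s'}"
proof (rule finite_subset)
  show "finite ((\<lambda>((s, y), (s', y')). (\<bar>y - y'\<bar> - lam) / d s s' powr \<alpha>) ` (D \<times> D))"
    using assms by simp
qed force

lemma lacki_const_ge:
  assumes "finite D" shows "Llow \<le> lacki_const d \<alpha> Llow lam D"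
  unfolding lacki_const_def using finite_lacki_quotients[OF assms] by (intro Max_ge) auto

lemma lacki_const_consistent:
  assumes "finite D" "(s, y) \<in> D" "(s', y') \<in> D" "0 < d s s'"
  shows "\<bar>y - y'\<bar> \<le> lam + lacki_const d \<alpha> Llow lam D * d s s' powr \<alpha>"
proof -
  have "(\<bar>y - y'\<bar> - lam) / d s s' powr \<alpha> \<le> lacki_const d \<alpha> Llow lam D"
    unfolding lacki_const_def using finite_lacki_quotients[OF assms(1)] assms(2-)
    by (intro Max_ge) auto
  then show ?thesis using assms(4) by (simp add: divide_le_eq)
qed

text \<open>Minimality: together with the two preceding lemmas, this identifies the estimate as the
  least constant above \<open>Llow\<close> that explains all samples at positive distance up to the
  tolerance \<open>lam\<close>.\<close>

lemma lacki_const_le: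
  assumes "finite D" "Llow \<le> C"
    and "\<And>s y s' y'. (s, y) \<in> D \<Longrightarrow> (s', y') \<in> D \<Longrightarrow> 0 < d s s' \<Longrightarrow>
      \<bar>y - y'\<bar> \<le> lam + C * d s s' powr \<alpha>"
  shows "lacki_const d \<alpha> Llow lam D \<le> C"
proof -
  have "(\<bar>y - y'\<bar> - lam) / d s s' powr \<alpha> \<le> C"
    if "(s, y) \<in> D" "(s', y') \<in> D" "0 < d s s'" for s y s' y'
    using assms(3)[OF that] that(3) by (simp add: divide_le_eq)
  then show ?thesis
    unfolding lacki_const_def using finite_lacki_quotients[OF assms(1)] assms(2) by auto
qed

text \<open>With \<open>T = L * d x g powr \<alpha>\<close>, the minimum lies between
  \<open>v - lam - T + e x\<close> and \<open>v + T + e x\<close>, the maximum between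
  \<open>v - T - e x\<close> and \<open>v + lam + T - e x\<close>. The sample at \<open>g\<close>
  gives one side of each, consistency with all other samples the opposite side. Averaging cancels
  \<open>e x\<close> and halves \<open>lam\<close>.\<close>

lemma lacki_near_sample:
  assumes d: "invariant_pseudometric d" and \<alpha>: "0 < \<alpha>" "\<alpha> \<le> 1"
    and D: "finite D" "(g, v) \<in> D"
    and L: "L = lacki_const d \<alpha> Llow lam D" "0 \<le> L"
    and consistent: "\<And>s y. (s, y) \<in> D \<Longrightarrow> \<bar>y - v\<bar> \<le> lam + L * d s g powr \<alpha>"
  shows "\<bar>lacki d \<alpha> Llow lam e D x - v\<bar> \<le> lam / 2 + L * d x g powr \<alpha>"
proof -
  define T where "T = L * d x g powr \<alpha>"
  define lo where "lo = (\<lambda>(s, y). y - L * d x s powr \<alpha> - e x)"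
  define up where "up = (\<lambda>(s, y). y + L * d x s powr \<alpha> + e x)"
  have dd: "0 \<le> d y z" "d y z = d z y" "d x z \<le> d x y + d y z" for x y z
    using d unfolding invariant_pseudometric_def by blast+
  \<comment> \<open>Consistency speaks of \<open>d s g\<close>; the triangle inequality through
    \<open>x\<close> and subadditivity of the power turn this into the distances from
    \<open>x\<close> that occur in the rule.\<close>
  have near: "\<bar>y - v\<bar> \<le> lam + T + L * d x s powr \<alpha>" if "(s, y) \<in> D" for s y
  proof -
    have "d s g powr \<alpha> \<le> (d x s + d x g) powr \<alpha>"
      using dd(1)[of s g] dd(2)[of s x] dd(3)[of s g x] \<alpha> by (intro powr_mono2) auto
    also have "\<dots> \<le> d x s powr \<alpha> + d x g powr \<alpha>"
      using dd(1) \<alpha> by (intro powr_add_le_add_powr) auto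
    finally have "L * d s g powr \<alpha> \<le> L * d x s powr \<alpha> + T"
      unfolding T_def using L(2) by (metis distrib_left mult_left_mono)
    then show ?thesis using consistent[OF that] by linarith
  qed
  have "Min (up ` D) \<le> up (g, v)"
    using D by (intro Min_le) auto
  moreover have "v - lam - T + e x \<le> Min (up ` D)"
  proof (rule Min.boundedI)
    fix a assume "a \<in> up ` D"
    then obtain s y where "(s, y) \<in> D" "a = y + L * d x s powr \<alpha> + e x"
      by (auto simp: up_def)
    then show "v - lam - T + e x \<le> a" using near[of s y] by linarith
  qed (use D in auto)
  moreover have "lo (g, v) \<le> Max (lo ` D)"
    using D by (intro Max_ge) auto
  moreover have "Max (lo ` D) \<le> v + lam + T - e x"
  proof (rule Max.boundedI)
    fix a assume "a \<in> lo ` D"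
    then obtain s y where "(s, y) \<in> D" "a = y - L * d x s powr \<alpha> - e x"
      by (auto simp: lo_def)
    then show "a \<le> v + lam + T - e x" using near[of s y] by linarith
  qed (use D in auto)
  moreover have "lacki d \<alpha> Llow lam e D x = 1/2 * Min (up ` D) + 1/2 * Max (lo ` D)"
    by (simp add: lacki_def up_def lo_def L(1))
  moreover have "up (g, v) = v + T + e x" "lo (g, v) = v - T - e x"
    by (auto simp: up_def lo_def T_def)
  ultimately show ?thesis
    unfolding T_def[symmetric] by (simp add: abs_le_iff)
qed

lemma lacki_error:
  assumes d: "invariant_pseudometric d" and \<alpha>: "0 < \<alpha>" "\<alpha> \<le> 1"
    and noise: "\<And>x. \<bar>ftilde x - f x\<bar> \<le> ebar"
    and D: "data_set ftilde D" "grid D \<subseteq> K"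
    and C: "0 \<le> C" "\<And>x y. x \<in> K \<Longrightarrow> y \<in> K \<Longrightarrow> \<bar>f x - f y\<bar> \<le> q + C * d x y powr \<alpha>"
    and x: "x \<in> K" and g: "g \<in> grid D"
  shows "\<bar>lacki d \<alpha> 0 (2 * ebar + q) e D x - f x\<bar> \<le>
    2 * ebar + 3 * q / 2 + 2 * C * d x g powr \<alpha>"
proof -
  define L where "L = lacki_const d \<alpha> 0 (2 * ebar + q) D"
  have fin: "finite D" and val: "\<And>s y. (s, y) \<in> D \<Longrightarrow> y = ftilde s"
    using D(1) by (auto simp: data_set_def)
  have gD: "(g, ftilde g) \<in> D" and gK: "g \<in> K"
    using g val D(2) by force+
  have ft: "\<bar>y - y'\<bar> \<le> 2 * ebar + q + C * d s s' powr \<alpha>"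
    if "(s, y) \<in> D" "(s', y') \<in> D" for s y s' y'
  proof -
    have "s \<in> K" "s' \<in> K" using that D(2) by force+
    then show ?thesis
      using C(2)[of s s'] noise[of s] noise[of s'] val[OF that(1)] val[OF that(2)] by linarith
  qed
  have L0: "0 \<le> L" unfolding L_def by (rule lacki_const_ge[OF fin])
  have LC: "L \<le> C" unfolding L_def
    using fin C(1) ft by (intro lacki_const_le) auto
  have "\<bar>y - ftilde g\<bar> \<le> 2 * ebar + q + L * d s g powr \<alpha>" if s: "(s, y) \<in> D" for s y
  proof (cases "0 < d s g")
    case True
    then show ?thesis unfolding L_def using lacki_const_consistent[OF fin s gD] by blast
  next
    case False
    \<comment> \<open>Pairs at distance zero do not enter the estimate. For them the power term
      vanishes, so \<open>ft\<close> bounds the difference by the tolerance alone.\<close>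
    then have "d s g = 0"
      using d unfolding invariant_pseudometric_def by (metis less_eq_real_def)
    then show ?thesis using ft[OF s gD] by simp
  qed
  then have "\<bar>lacki d \<alpha> 0 (2 * ebar + q) e D x - ftilde g\<bar> \<le>
      (2 * ebar + q) / 2 + L * d x g powr \<alpha>"
    by (rule lacki_near_sample[OF d \<alpha> fin gD L_def L0])
  moreover have "L * d x g powr \<alpha> \<le> C * d x g powr \<alpha>"
    using LC by (simp add: mult_right_mono)
  moreover have "\<bar>P - f x\<bar> \<le> \<bar>P - ftilde g\<bar> + \<bar>ftilde g - f g\<bar> + \<bar>f x - f g\<bar>" for P
    by linarith
  \<comment> \<open>The three summands are the prediction error relative to the sample at
    \<open>g\<close>, the noise at \<open>g\<close>, and the variation of \<open>f\<close> between
    \<open>x\<close> and \<open>g\<close>. The constants add up to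
    \<open>2 * ebar + 3 * q / 2\<close>: half of \<open>q\<close> comes from the tolerance, a whole
    \<open>q\<close> from the target.\<close>
  ultimately have "\<bar>lacki d \<alpha> 0 (2 * ebar + q) e D x - f x\<bar> \<le>
      ((2 * ebar + q) / 2 + C * d x g powr \<alpha>) + ebar + (q + C * d x g powr \<alpha>)"
    using C(2)[OF x gK] noise[of g] by (meson add_left_mono add_mono order_trans)
  then show ?thesis by (simp add: field_simps)
qed

section \<open>From error bounds to rates of convergence\<close>

lemma converges_to_atLeastAtMost_with_rate:
  assumes "0 \<le> B" "\<And>n. 0 \<le> a n" "\<And>n. a n \<le> B + \<rho> n" "\<And>n. 0 \<le> \<rho> n" "\<rho> \<longlonglongrightarrow> 0"
  shows "converges_to_set_with_rate a {0..B} \<rho>"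
  unfolding converges_to_set_with_rate_def
proof (intro conjI allI)
  fix n
  \<comment> \<open>For a nonnegative \<open>a n\<close>, the nearest point of the interval is
    \<open>min (a n) B\<close>.\<close>
  have "(INF y\<in>{0..B}. \<bar>y - a n\<bar>) \<le> \<bar>min (a n) B - a n\<bar>"
    using assms(1,2) by (intro cINF_lower bdd_belowI2[of _ 0]) auto
  also have "\<dots> \<le> \<rho> n" using assms(3,4)[of n] by (auto simp: min_def)
  finally show "(INF y\<in>{0..B}. \<bar>y - a n\<bar>) \<le> \<rho> n" .
qed (fact assms(5))

text \<open>Compactness of \<open>I\<close> bounds the distances to the grid, so the supremum
  dominates the value at each \<open>x\<close>. Finiteness of the grid turns the infimum into a
  minimum, attained at an actual grid point.\<close>

lemma uniformly_dense_nearest: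
  assumes d: "invariant_pseudometric d" and I: "compactin (pm_topology d) I"
    and G: "finite (G n)" "G n \<noteq> {}"
    and r: "uniformly_dense_with_rate d G I r" and "x \<in> I"
  obtains g where "g \<in> G n" "d x g \<le> r n"
proof -
  have INF: "(INF g\<in>G n. d y g) = Min (d y ` G n)" for y
    using G by (intro cInf_eq_Min) auto
  obtain a where a: "a \<in> G n" using G(2) by blast
  obtain M where M: "\<And>y. y \<in> I \<Longrightarrow> d y a \<le> M"
    using compactin_pm_dist_bounded[OF d I] by blast
  have "(INF g\<in>G n. d y g) \<le> M" if "y \<in> I" for y
    unfolding INF using M[OF that] G(1) a by (meson Min_le finite_imageI imageI order_trans)
  then have "(INF g\<in>G n. d x g) \<le> (SUP y\<in>I. INF g\<in>G n. d y g)"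
    using \<open>x \<in> I\<close> by (intro cSUP_upper bdd_aboveI2) auto
  also have "\<dots> \<le> r n"
    using r unfolding uniformly_dense_with_rate_def by blast
  finally have "Min (d x ` G n) \<le> r n" unfolding INF .
  moreover have "Min (d x ` G n) \<in> d x ` G n" using G by (intro Min_in) auto
  ultimately show ?thesis using that by auto
qed

theorem theorem2p14:
  fixes d :: "'a::ab_group_add \<Rightarrow> 'a \<Rightarrow> real"
    and f ftilde e :: "'a \<Rightarrow> real"
    and D :: "nat \<Rightarrow> ('a \<times> real) set"
    and I :: "'a set"
    and \<alpha> ebar q :: real
  assumes "invariant_pseudometric d"
    and "0 < \<alpha>" and "\<alpha> \<le> 1"
    and "\<And>x. 0 \<le> e x"
    and "0 \<le> ebar"
    and "\<And>x. \<bar>ftilde x - f x\<bar> \<le> ebar"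
    and "\<And>n. data_set ftilde (D n)"
    and "0 < q"
    and "compactin (pm_topology d) I" and "I \<noteq> {}"
    and "\<exists>K. compactin (pm_topology d) K \<and> (\<forall>n. grid (D n) \<subseteq> K)"
    and "continuous_map (pm_topology d) euclideanreal f"
  defines "fhat \<equiv> \<lambda>n. lacki d \<alpha> 0 (2 * ebar + q) e (D n)"
  shows "(\<forall>x\<in>I. \<forall>r. dense_at_with_rate d (\<lambda>n. grid (D n)) x r \<longrightarrow>
            (\<exists>C. converges_to_set_with_rate (\<lambda>n. \<bar>fhat n x - f x\<bar>)
                   {0 .. 2 * ebar + 3 * q / 2} (\<lambda>n. C * r n powr \<alpha>))) \<and>
         (\<forall>r. uniformly_dense_with_rate d (\<lambda>n. grid (D n)) I r \<longrightarrow>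
            (\<exists>C. converges_to_set_with_rate (\<lambda>n. SUP x\<in>I. \<bar>fhat n x - f x\<bar>)
                   {0 .. 2 * ebar + 3 * q / 2} (\<lambda>n. C * r n powr \<alpha>)))"
proof -
  define B where "B = 2 * ebar + 3 * q / 2"
  have B: "0 \<le> B" using assms(5,8) by (simp add: B_def)
  obtain K where K: "compactin (pm_topology d) K" "\<And>n. grid (D n) \<subseteq> K"
    using assms(11) by blast
  \<comment> \<open>One compact set holds every grid and every point of interest, so a single
    \<open>C\<close> serves all \<open>n\<close> and all \<open>x\<close>.\<close>
  have "compactin (pm_topology d) (K \<union> I)"
    using K(1) assms(9) by (rule compactin_Un)
  then obtain C where C: "0 \<le> C"
    "\<And>x y. x \<in> K \<union> I \<Longrightarrow> y \<in> K \<union> I \<Longrightarrow> \<bar>f x - f y\<bar> \<le> q + C * d x y powr \<alpha>"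
    using compactin_pm_hoelder_up_to[OF assms(1,12) _ assms(8,2)] by blast
  have nonneg: "0 \<le> d x y" for x y
    using assms(1) unfolding invariant_pseudometric_def by blast
  have bound: "\<bar>fhat n x - f x\<bar> \<le> B + 2 * C * r powr \<alpha>"
    if "x \<in> I" "g \<in> grid (D n)" "d x g \<le> r" for n x g r
  proof -
    have "grid (D n) \<subseteq> K \<union> I" "x \<in> K \<union> I"
      using K(2)[of n] that(1) by auto
    then have "\<bar>fhat n x - f x\<bar> \<le> B + 2 * C * d x g powr \<alpha>"
      unfolding fhat_def B_def
      using that(2) by (intro lacki_error[OF assms(1-3,6,7) _ C]) assumption+
    also have "\<dots> \<le> B + 2 * C * r powr \<alpha>"
      using that(3) C(1) nonneg[of x g] assms(2)
      by (intro add_left_mono mult_left_mono powr_mono2) auto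
    finally show ?thesis .
  qed
  have rate: "(\<lambda>n. 2 * C * r n powr \<alpha>) \<longlonglongrightarrow> 0" if "r \<longlonglongrightarrow> 0" "\<And>n. 0 \<le> r n" for r :: "nat \<Rightarrow> real"
    using tendsto_zero_powrI[OF that(1) tendsto_const _ assms(2)] that(2)
    by (intro tendsto_mult_right_zero) auto
  have "converges_to_set_with_rate (\<lambda>n. \<bar>fhat n x - f x\<bar>) {0..B} (\<lambda>n. 2 * C * r n powr \<alpha>)"
    if "x \<in> I" and r: "dense_at_with_rate d (\<lambda>n. grid (D n)) x r" for x r
  proof -
    have near: "\<exists>g\<in>grid (D n). d x g \<le> r n" for n
      using r unfolding dense_at_with_rate_def by blast
    \<comment> \<open>A rate is not assumed nonnegative, but each of its values bounds a
      distance.\<close>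
    then have "0 \<le> r n" for n using nonneg by (meson order_trans)
    then have "(\<lambda>n. 2 * C * r n powr \<alpha>) \<longlonglongrightarrow> 0"
      using r unfolding dense_at_with_rate_def by (intro rate) auto
    then show ?thesis
      using B C(1) bound[OF \<open>x \<in> I\<close>] near
      by (intro converges_to_atLeastAtMost_with_rate) (auto, blast)
  qed
  moreover have "converges_to_set_with_rate (\<lambda>n. SUP x\<in>I. \<bar>fhat n x - f x\<bar>) {0..B}
      (\<lambda>n. 2 * C * r n powr \<alpha>)"
    if r: "uniformly_dense_with_rate d (\<lambda>n. grid (D n)) I r" for r
  proof -
    \<comment> \<open>Any point of \<open>I\<close> serves as a witness that the rate and the
      worst-case error are nonnegative.\<close>
    obtain z where z: "z \<in> I" using assms(10) by blast
    have near: "\<exists>g\<in>grid (D n). d x g \<le> r n" if "x \<in> I" for n x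
      using uniformly_dense_nearest[OF assms(1,9) _ _ r that, of n] assms(7)[of n]
      unfolding data_set_def by auto
    then have "0 \<le> r n" for n using nonneg z by (meson order_trans)
    then have lim: "(\<lambda>n. 2 * C * r n powr \<alpha>) \<longlonglongrightarrow> 0"
      using r unfolding uniformly_dense_with_rate_def by (intro rate) auto
    \<comment> \<open>The right-hand side is independent of \<open>x\<close>: it shows that the
      errors are bounded above on \<open>I\<close> and also bounds their supremum.\<close>
    have le: "\<bar>fhat n x - f x\<bar> \<le> B + 2 * C * r n powr \<alpha>" if "x \<in> I" for n x
      using near[OF that] bound[OF that] by blast
    have "0 \<le> (SUP x\<in>I. \<bar>fhat n x - f x\<bar>)" for n
      using le by (intro cSUP_upper2[OF _ z] bdd_aboveI2) auto
    moreover have "(SUP x\<in>I. \<bar>fhat n x - f x\<bar>) \<le> B + 2 * C * r n powr \<alpha>" for n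
      using assms(10) le by (rule cSUP_least)
    ultimately show ?thesis
      using B C(1) lim by (intro converges_to_atLeastAtMost_with_rate) auto
  qed
  ultimately show ?thesis unfolding B_def by blast
qed

end
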